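(* Let $d\ge2$ and let an axis-parallel hypercuboid in $\mathbb{R}^d$ be tiled by $n$ axis-parallel hypercuboids $C_1,\dots,C_n$, where for each $k$ there are positive integers $q_{k,1},\dots,q_{k,d}$ and a real $c_k>0$ such that the side of $C_k$ parallel to the $j$-th coordinate axis has length $c_kq_{k,j}$ for all $j=1,\dots,d$. Suppose the longest side of the tiled hypercuboid is parallel to the $i$-th coordinate axis. Then for any $j\ne i$ there is a positive real $\lambda$ such that, after scaling the whole configuration by $\lambda$, the longest side of the scaled hypercuboid has length at most $8^{n}\prod_{k=1}^n\max\{q_{k,i},q_{k,j}\}$ and all tiles have integer side lengths.
   Context: A tiling of a region means a finite family of closed tiles with pairwise disjoint interiors whose union is the region. *)

theory Defs
  imports "HOL-Analysis.Analysis"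
begin

definition hypercuboid :: "(real ^ 'd) set \<Rightarrow> bool" where
  "hypercuboid S \<longleftrightarrow> (\<exists>a b. (\<forall>j. a $ j < b $ j) \<and> S = cbox a b)"

(* Only meaningful for hypercuboids: the length of the sides parallel to the j-th axis. *)
definition side_length :: "(real ^ 'd) set \<Rightarrow> 'd \<Rightarrow> real" where
  "side_length S j = interval_upperbound S $ j - interval_lowerbound S $ j"

definition longest_side :: "(real ^ 'd) set \<Rightarrow> real" where
  "longest_side S = Max (range (side_length S))"

definition tiling :: "'k set \<Rightarrow> ('k \<Rightarrow> 'a::topological_space set) \<Rightarrow> 'a set \<Rightarrow> bool" where
  "tiling I T R \<longleftrightarrow> finite I \<and> (\<forall>k\<in>I. closed (T k)) \<and>
     disjoint_family_on (\<lambda>k. interior (T k)) I \<and> (\<Union>k\<in>I. T k) = R"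

lemma side_length_cbox:
  fixes a b :: "real ^ 'd"
  assumes "\<forall>j. a $ j < b $ j"
  shows "side_length (cbox a b) j = b $ j - a $ j"
proof -
  have "\<forall>i\<in>Basis. a \<bullet> i \<le> b \<bullet> i"
    using assms by (auto simp: Basis_vec_def inner_axis less_imp_le)
  then show ?thesis
    by (simp add: side_length_def)
qed

end

theory Submission
  imports "Jordan_Normal_Form.Determinant" Defs
begin

text \<open>
  Assign an unknown to every value occurring as the $i$-th or $j$-th coordinate of a tile face,
  measured from the lower face of the big box, and one unknown $c_k$ to every tile. The tiles give
  $2n$ homogeneous integer equations $x' - x = c_k q_{k,i}$ and $y' - y = c_k q_{k,j}$.
  The solution space is one-dimensional. Indeed, for arbitrary functions $F_m$ the set function
  $\prod_m (F_m(b_m) - F_m(a_m))$ is additive on boxes. Let $F_i$ and $F_j$ come from a solution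
  that vanishes on the big side in direction $i$, and let the other $F_m$ be the identity.
  Additivity becomes $\sum_k q_{k,i} q_{k,j} c_k^2 w_k = 0$ with weights $w_k > 0$, so every $c_k$ is $0$.
  The cofactors of a maximal set of independent equations therefore form an integral multiple of
  the actual configuration, and the length of the big side is a minor. Let
  $M_k = \max\{q_{k,i}, q_{k,j}\}$. After weighting the column of $c_k$ by $2/M_k$ all rows have
  $\ell^1$-norm at most $4$, so the minor is at most $4^{2n} \prod_k M_k/2 = 8^n \prod_k M_k$.
\<close>

no_notation vec_index (infixl "$" 100)

section \<open>Determinant bounds and integral kernel vectors\<close>

text \<open>Expanding the product of the weighted row sums gives one nonnegative term for every map
  from rows to columns. The Leibniz formula bounds the left side by the terms of the permutations
  alone, since a permutation meets every column, and hence every weight, exactly once.\<close>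

lemma abs_det_le_prod_row_sums:
  fixes A :: "real mat" and t :: "nat \<Rightarrow> real"
  assumes A: "A \<in> carrier_mat n n" and t: "\<And>v. v < n \<Longrightarrow> 0 \<le> t v"
  shows "\<bar>Determinant.det A\<bar> * (\<Prod>v<n. t v) \<le> (\<Prod>a<n. \<Sum>v<n. \<bar>A $$ (a, v)\<bar> * t v)"
proof -
  define S where "S = {0..<n}"
  define P where "P = {p. p permutes S}"
  define h where "h = (\<lambda>p. \<Prod>a\<in>S. \<bar>A $$ (a, p a)\<bar> * t (p a))"
  have finS: "finite S" and finP: "finite P"
    by (simp_all add: S_def P_def finite_permutations)
  have tS: "0 \<le> t v" if "v \<in> S" for v using that t by (simp add: S_def)
  have "\<bar>Determinant.det A\<bar> \<le> (\<Sum>p\<in>P. \<Prod>a\<in>S. \<bar>A $$ (a, p a)\<bar>)"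
    unfolding det_def'[OF A] P_def S_def
    by (rule order_trans[OF sum_abs]) (auto simp: abs_mult abs_prod sign_def intro!: sum_mono)
  then have "\<bar>Determinant.det A\<bar> * (\<Prod>v\<in>S. t v) \<le> (\<Sum>p\<in>P. \<Prod>a\<in>S. \<bar>A $$ (a, p a)\<bar>) * (\<Prod>v\<in>S. t v)"
    by (intro mult_right_mono prod_nonneg) (auto simp: tS)
  also have "\<dots> = (\<Sum>p\<in>P. (\<Prod>a\<in>S. \<bar>A $$ (a, p a)\<bar>) * (\<Prod>v\<in>S. t v))"
    by (simp add: sum_distrib_right)
  also have "\<dots> = sum h P"
  proof (rule sum.cong[OF refl])
    fix p assume "p \<in> P"
    then have "(\<Prod>v\<in>S. t v) = (\<Prod>a\<in>S. t (p a))"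
      using prod.permute[of p S t] by (simp add: P_def o_def)
    then show "(\<Prod>a\<in>S. \<bar>A $$ (a, p a)\<bar>) * (\<Prod>v\<in>S. t v) = h p"
      by (simp add: h_def prod.distrib)
  qed
  \<comment> \<open>A permutation is the identity outside \<open>S\<close>, whereas elements of
    \<open>PiE\<close> are \<open>undefined\<close> there. Restriction translates between the two
    and is injective on \<open>P\<close>.\<close>
  also have "\<dots> = (\<Sum>p\<in>P. h (restrict p S))"
    by (simp add: h_def)
  also have "\<dots> = sum h ((\<lambda>p. restrict p S) ` P)"
  proof (rule sum.reindex_cong[symmetric, OF _ refl refl], rule inj_onI)
    fix p p' assume "p \<in> P" "p' \<in> P" and eq: "restrict p S = restrict p' S"
    show "p = p'"
    proof
      fix x
      have "restrict p S x = restrict p' S x" by (simp only: eq)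
      with \<open>p \<in> P\<close> \<open>p' \<in> P\<close> show "p x = p' x"
        by (cases "x \<in> S") (simp_all add: P_def permutes_not_in)
    qed
  qed
  also have "\<dots> \<le> sum h (PiE S (\<lambda>_. S))"
  proof (rule sum_mono2)
    show "(\<lambda>p. restrict p S) ` P \<subseteq> PiE S (\<lambda>_. S)"
      by (auto simp: P_def permutes_in_image)
    show "0 \<le> h p" if "p \<in> PiE S (\<lambda>_. S) - (\<lambda>p. restrict p S) ` P" for p
      unfolding h_def using that tS by (intro prod_nonneg mult_nonneg_nonneg) (auto simp: PiE_iff)
  qed (simp add: finS finite_PiE)
  also have "\<dots> = (\<Prod>a\<in>S. \<Sum>v\<in>S. \<bar>A $$ (a, v)\<bar> * t v)"
    unfolding h_def using finS by (subst prod_sum_PiE) auto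
  finally show ?thesis by (simp add: S_def lessThan_atLeast0)
qed

text \<open>By \<open>uniq\<close> the kernel is the line through \<open>z\<close>. The signed
  maximal minors of \<open>N\<close> rows, independent on the first \<open>N\<close> columns, form
  an integral kernel vector, hence a multiple of \<open>z\<close>. Its entry at \<open>N\<close> is
  the minor of these columns, to which the row-sum bound applies.\<close>

lemma kernel_vector_integer_multiple_nat:
  fixes A :: "'r \<Rightarrow> nat \<Rightarrow> real" and z t :: "nat \<Rightarrow> real"
  assumes int: "\<And>r v. r \<in> Rw \<Longrightarrow> v < Suc N \<Longrightarrow> A r v \<in> \<int>"
    and z: "\<And>r. r \<in> Rw \<Longrightarrow> (\<Sum>v<Suc N. A r v * z v) = 0" and zN: "z N \<noteq> 0"
    and uniq: "\<And>w v. (\<And>r. r \<in> Rw \<Longrightarrow> (\<Sum>v<Suc N. A r v * w v) = 0) \<Longrightarrow> w N = 0 \<Longrightarrow> v < Suc N \<Longrightarrow> w v = 0"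
    and t: "\<And>v. v < N \<Longrightarrow> 0 \<le> t v"
  shows "\<exists>l S. l \<noteq> 0 \<and> (\<forall>v<Suc N. l * z v \<in> \<int>) \<and> inj_on S {..<N} \<and> S ` {..<N} \<subseteq> Rw \<and>
     \<bar>l * z N\<bar> * (\<Prod>v<N. t v) \<le> (\<Prod>a<N. \<Sum>v<N. \<bar>A (S a) v\<bar> * t v)"
proof -
  define minor where "minor = (\<lambda>m S. Determinant.det (Matrix.mat m m (\<lambda>(a, v). A (S a) v)))"
  \<comment> \<open>\<open>w m S v\<close> is the cofactor of entry \<open>(m, v)\<close> in any
    square matrix of size \<open>m + 1\<close> whose first \<open>m\<close> rows are given by
    \<open>S\<close>: column \<open>v\<close> is skipped, and the last row does not enter.\<close>
  define w where "w = (\<lambda>m S v. (-1) ^ (m + v) * Determinant.det (Matrix.mat m m (\<lambda>(a, u). A (S a) (if u < v then u else Suc u))))"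
  have w_last: "w m S m = minor m S" for m and S :: "nat \<Rightarrow> 'r"
  proof -
    have "Matrix.mat m m (\<lambda>(a, u). A (S a) (if u < m then u else Suc u)) = Matrix.mat m m (\<lambda>(a, v). A (S a) v)"
      by (rule eq_matI) auto
    then show ?thesis by (simp add: w_def minor_def)
  qed
  \<comment> \<open>Laplace expansion along the appended row: \<open>r\<close> annihilates the
    cofactor vector exactly when bordering by \<open>r\<close> yields a zero minor.\<close>
  have bordered: "minor (Suc m) (S(m := r)) = (\<Sum>v<Suc m. A r v * w m S v)" for m r and S :: "nat \<Rightarrow> 'r"
  proof -
    define B where "B = Matrix.mat (Suc m) (Suc m) (\<lambda>(a, v). A ((S(m := r)) a) v)"
    have B: "B \<in> carrier_mat (Suc m) (Suc m)" by (simp add: B_def)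
    have "cofactor B m v = w m S v" if "v < Suc m" for v
    proof -
      have "mat_delete B m v = Matrix.mat m m (\<lambda>(a, u). A (S a) (if u < v then u else Suc u))"
        by (rule eq_matI) (auto simp: mat_delete_def B_def)
      then show ?thesis by (simp add: cofactor_def w_def)
    qed
    moreover have "Determinant.det B = (\<Sum>v<Suc m. B $$ (m, v) * cofactor B m v)"
      by (rule laplace_expansion_row[OF B]) simp
    ultimately show ?thesis
      unfolding minor_def B_def[symmetric] by (simp add: B_def)
  qed
  have minor_repeat: "minor m S = 0" if "a < m" "b < m" "a \<noteq> b" "S a = S b" for m a b and S :: "nat \<Rightarrow> 'r"
    unfolding minor_def by (rule Determinant.det_identical_rows[OF _ that(3,1,2)]) (use that in \<open>auto intro!: eq_vecI\<close>)
  \<comment> \<open>Any \<open>N + 1\<close> rows, repeated or not, have the nonzero vector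
    \<open>z\<close> in their common kernel.\<close>
  have full_minor: "minor (Suc N) S = 0" if S: "S ` {..<Suc N} \<subseteq> Rw" for S
  proof -
    define B where "B = Matrix.mat (Suc N) (Suc N) (\<lambda>(a, v). A (S a) v)"
    have B: "B \<in> carrier_mat (Suc N) (Suc N)" by (simp add: B_def)
    have "B *\<^sub>v Matrix.vec (Suc N) z = 0\<^sub>v (Suc N)"
    proof (rule eq_vecI)
      fix a assume "a < dim_vec (0\<^sub>v (Suc N) :: real Matrix.vec)"
      then have a: "a < Suc N" by simp
      then have "S a \<in> Rw" using S by auto
      from z[OF this] a show "vec_index (B *\<^sub>v Matrix.vec (Suc N) z) a = vec_index (0\<^sub>v (Suc N)) a"
        by (simp add: B_def scalar_prod_def lessThan_atLeast0)
    qed (simp add: B_def)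
    moreover have "Matrix.vec (Suc N) z \<noteq> 0\<^sub>v (Suc N)"
    proof
      assume "Matrix.vec (Suc N) z = 0\<^sub>v (Suc N)"
      then have "vec_index (Matrix.vec (Suc N) z) N = vec_index (0\<^sub>v (Suc N)) N" by simp
      with zN show False by simp
    qed
    ultimately have "Determinant.det B = 0"
      using det_0_iff_vec_prod_zero[OF B] by (meson vec_carrier)
    then show ?thesis by (simp add: minor_def B_def)
  qed
  \<comment> \<open>A nonzero minor on the first \<open>m\<close> columns extends by a column and a row: its cofactor vector
    vanishes at \<open>N\<close>, so it is not in the kernel, and a row detecting this borders the minor.\<close>
  have "\<exists>S. S ` {..<m} \<subseteq> Rw \<and> minor m S \<noteq> 0" if "m \<le> N" for m
    using that
  proof (induction m)
    case 0
    then show ?case by (simp add: minor_def)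
  next
    case (Suc m)
    then obtain S where S: "S ` {..<m} \<subseteq> Rw" and nz: "minor m S \<noteq> 0" by auto
    define w' where "w' = (\<lambda>v. if v < Suc m then w m S v else 0)"
    have "w' m \<noteq> 0" "w' N = 0" using nz w_last Suc.prems by (auto simp: w'_def)
    with uniq[of w' m] Suc.prems obtain r where r: "r \<in> Rw" "(\<Sum>v<Suc N. A r v * w' v) \<noteq> 0"
      by force
    have "(\<Sum>v<Suc N. A r v * w' v) = (\<Sum>v<Suc m. A r v * w' v)"
      using Suc.prems by (intro sum.mono_neutral_right) (auto simp: w'_def)
    also have "\<dots> = minor (Suc m) (S(m := r))"
      unfolding bordered by (rule sum.cong) (auto simp: w'_def)
    finally have "minor (Suc m) (S(m := r)) \<noteq> 0" using r by simp
    moreover have "(S(m := r)) ` {..<Suc m} \<subseteq> Rw" using S r by (auto simp: less_Suc_eq)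
    ultimately show ?case by blast
  qed
  then obtain S where S: "S ` {..<N} \<subseteq> Rw" and nz: "minor N S \<noteq> 0" by blast
  \<comment> \<open>With this choice \<open>l * z\<close> and the cofactor vector agree at
    \<open>N\<close>; both lie in the kernel, so \<open>uniq\<close> applied to their difference
    makes them equal.\<close>
  define l where "l = minor N S / z N"
  have w_ker: "(\<Sum>v<Suc N. A r v * w N S v) = 0" if "r \<in> Rw" for r
    unfolding bordered[symmetric] by (rule full_minor) (use S that in \<open>auto simp: less_Suc_eq\<close>)
  have "w N S v = l * z v" if "v < Suc N" for v
  proof -
    have "w N S v - l * z v = 0"
    proof (rule uniq[of "\<lambda>v. w N S v - l * z v"])
      fix r assume r: "r \<in> Rw"
      have "(\<Sum>v<Suc N. A r v * (w N S v - l * z v)) = (\<Sum>v<Suc N. A r v * w N S v) - l * (\<Sum>v<Suc N. A r v * z v)"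
        unfolding sum_distrib_left sum_subtractf[symmetric]
        by (rule sum.cong) (simp_all add: algebra_simps)
      then show "(\<Sum>v<Suc N. A r v * (w N S v - l * z v)) = 0"
        using w_ker[OF r] z[OF r] by simp
    qed (use that zN in \<open>simp_all add: w_last l_def\<close>)
    then show ?thesis by simp
  qed
  moreover have "w N S v \<in> \<int>" if "v < Suc N" for v
  proof -
    have "Determinant.det (Matrix.mat N N (\<lambda>(a, u). A (S a) (if u < v then u else Suc u))) \<in> \<int>"
      unfolding det_def'[OF mat_carrier]
    proof (intro Ints_sum Ints_mult Ints_prod)
      fix p a assume "p \<in> {p. p permutes {0..<N}}" "a \<in> {0..<N}"
      then have "p a < N" "a < N" using permutes_in_image by fastforce+
      then show "Matrix.mat N N (\<lambda>(a, u). A (S a) (if u < v then u else Suc u)) $$ (a, p a) \<in> \<int>"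
        using S by (auto intro!: int)
    qed (auto simp: sign_def)
    then show ?thesis by (simp add: w_def)
  qed
  moreover have "inj_on S {..<N}"
  proof (rule inj_onI, rule ccontr)
    fix a b assume "a \<in> {..<N}" "b \<in> {..<N}" "S a = S b" "a \<noteq> b"
    then have "minor N S = 0" by (intro minor_repeat[where a = a and b = b]) simp_all
    with nz show False by simp
  qed
  moreover have "\<bar>l * z N\<bar> * (\<Prod>v<N. t v) \<le> (\<Prod>a<N. \<Sum>v<N. \<bar>A (S a) v\<bar> * t v)"
    using abs_det_le_prod_row_sums[OF mat_carrier[of N N "\<lambda>(a, v). A (S a) v"] t] zN
    by (simp add: l_def minor_def)
  moreover have "l \<noteq> 0" using nz zN by (simp add: l_def)
  ultimately show ?thesis using S by (intro exI[of _ l] exI[of _ S]) simp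
qed

text \<open>Enumerating \<open>V\<close> with \<open>v0\<close> last reduces this to columns indexed
  by numbers. A uniform bound \<open>K\<close> replaces the individual row sums.\<close>

lemma kernel_vector_integer_multiple:
  fixes A :: "'r \<Rightarrow> 'v \<Rightarrow> real" and z t :: "'v \<Rightarrow> real"
  assumes fin: "finite V" "finite Rw" and v0: "v0 \<in> V"
    and int: "\<And>r v. r \<in> Rw \<Longrightarrow> v \<in> V \<Longrightarrow> A r v \<in> \<int>"
    and z: "\<And>r. r \<in> Rw \<Longrightarrow> (\<Sum>v\<in>V. A r v * z v) = 0" and z0: "z v0 \<noteq> 0"
    and uniq: "\<And>w v. (\<And>r. r \<in> Rw \<Longrightarrow> (\<Sum>v\<in>V. A r v * w v) = 0) \<Longrightarrow> w v0 = 0 \<Longrightarrow> v \<in> V \<Longrightarrow> w v = 0"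
    and t: "\<And>v. v \<in> V \<Longrightarrow> 0 \<le> t v"
    and K: "1 \<le> K" "\<And>r. r \<in> Rw \<Longrightarrow> (\<Sum>v\<in>V - {v0}. \<bar>A r v\<bar> * t v) \<le> K"
  shows "\<exists>l. l \<noteq> 0 \<and> (\<forall>v\<in>V. l * z v \<in> \<int>) \<and> \<bar>l * z v0\<bar> * (\<Prod>v\<in>V - {v0}. t v) \<le> K ^ card Rw"
proof -
  define N where "N = card (V - {v0})"
  obtain e0 where e0: "bij_betw e0 {..<N} (V - {v0})"
    using fin ex_bij_betw_nat_finite[of "V - {v0}"] by (auto simp: N_def lessThan_atLeast0)
  define e where "e = e0(N := v0)"
  have eN: "e N = v0" by (simp add: e_def)
  have e1: "bij_betw e {..<N} (V - {v0})"
    using e0 by (rule bij_betw_cong[THEN iffD1, rotated]) (simp add: e_def)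
  have e: "bij_betw e {..<Suc N} V"
    using notIn_Un_bij_betw[of N "{..<N}" e "V - {v0}"] e1 v0
    by (simp add: eN lessThan_Suc insert_absorb)
  define e' where "e' = the_inv_into {..<Suc N} e"
  have e'e: "e' (e v) = v" if "v < Suc N" for v
    unfolding e'_def using e that by (intro the_inv_into_f_f) (auto simp: bij_betw_def)
  have sumV: "(\<Sum>v\<in>V. g v) = (\<Sum>v<Suc N. g (e v))" for g :: "'v \<Rightarrow> real"
    using sum.reindex_bij_betw[OF e] by metis
  have mem: "e v \<in> V" if "v < Suc N" for v using e that by (auto simp: bij_betw_def)
  obtain l S where l: "l \<noteq> 0" "\<forall>v<Suc N. l * z (e v) \<in> \<int>" and S: "inj_on S {..<N}" "S ` {..<N} \<subseteq> Rw"
    and le: "\<bar>l * z (e N)\<bar> * (\<Prod>v<N. t (e v)) \<le> (\<Prod>a<N. \<Sum>v<N. \<bar>A (S a) (e v)\<bar> * t (e v))"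
  proof (rule exE[OF kernel_vector_integer_multiple_nat[of Rw N "\<lambda>r v. A r (e v)" "\<lambda>v. z (e v)" "\<lambda>v. t (e v)"]])
    fix w v assume w: "\<And>r. r \<in> Rw \<Longrightarrow> (\<Sum>v<Suc N. A r (e v) * w v) = 0" "w N = 0" "v < Suc N"
    have "w (e' (e v)) = 0"
    proof (rule uniq[of "\<lambda>v. w (e' v)"])
      show "(\<Sum>v\<in>V. A r v * w (e' v)) = 0" if "r \<in> Rw" for r
        unfolding sumV using w(1)[OF that] by (simp add: e'e)
    qed (use w e'e[of N] mem in \<open>simp_all add: eN\<close>)
    then show "w v = 0" using w by (simp add: e'e)
  qed (use int z z0 t mem in \<open>auto simp: sumV eN\<close>)
  have "(\<Prod>a<N. \<Sum>v<N. \<bar>A (S a) (e v)\<bar> * t (e v)) \<le> (\<Prod>a<N. K)"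
  proof (rule prod_mono)
    fix a assume "a \<in> {..<N}"
    then have "S a \<in> Rw" using S by auto
    moreover have "(\<Sum>v<N. \<bar>A (S a) (e v)\<bar> * t (e v)) = (\<Sum>v\<in>V - {v0}. \<bar>A (S a) v\<bar> * t v)"
      by (rule sum.reindex_bij_betw[OF e1])
    ultimately show "0 \<le> (\<Sum>v<N. \<bar>A (S a) (e v)\<bar> * t (e v)) \<and> (\<Sum>v<N. \<bar>A (S a) (e v)\<bar> * t (e v)) \<le> K"
      using K t mem by (auto intro!: sum_nonneg)
  qed
  \<comment> \<open>The \<open>N\<close> chosen rows are distinct, so \<open>N\<close> is at most
    \<open>card Rw\<close>, and the powers of \<open>K\<close> increase because \<open>K\<close> is
    at least 1.\<close>
  also have "\<dots> \<le> K ^ card Rw"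
    using K(1) card_inj_on_le[OF S fin(2)] by (simp add: power_increasing)
  finally have "\<bar>l * z v0\<bar> * (\<Prod>v<N. t (e v)) \<le> K ^ card Rw"
    using le by (simp add: eN)
  moreover have "(\<Prod>v<N. t (e v)) = (\<Prod>v\<in>V - {v0}. t v)"
    by (rule prod.reindex_bij_betw[OF e1])
  moreover have "\<forall>v\<in>V. l * z v \<in> \<int>"
    using l(2) bij_betw_imp_surj_on[OF e] by auto
  ultimately show ?thesis using l(1) by auto
qed

section \<open>Additive set functions on boxes\<close>

lemma cbox_eq_empty_vec:
  fixes a b :: "real ^ 'd"
  shows "cbox a b = {} \<longleftrightarrow> (\<exists>m. b $ m < a $ m)" "box a b = {} \<longleftrightarrow> (\<exists>m. b $ m \<le> a $ m)"
  by (auto simp: box_eq_empty Basis_vec_def inner_axis)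

lemma interval_bounds_cbox_vec:
  fixes a b :: "real ^ 'd"
  assumes "\<And>m. a $ m \<le> b $ m"
  shows "interval_upperbound (cbox a b) = b" "interval_lowerbound (cbox a b) = a"
proof -
  have "\<forall>i\<in>Basis. a \<bullet> i \<le> b \<bullet> i"
    using assms by (auto simp: Basis_vec_def inner_axis)
  then show "interval_upperbound (cbox a b) = b" "interval_lowerbound (cbox a b) = a" by simp_all
qed

text \<open>The empty box is singled out because the bounds of the empty set are unspecified.\<close>

definition box_mass :: "('d \<Rightarrow> real \<Rightarrow> real) \<Rightarrow> (real ^ 'd) set \<Rightarrow> real" where
  "box_mass F S = (if S = {} then 0 else \<Prod>m\<in>UNIV. F m (interval_upperbound S $ m) - F m (interval_lowerbound S $ m))"

lemma box_mass_cbox: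
  fixes a b :: "real ^ 'd"
  assumes "\<And>m. a $ m \<le> b $ m"
  shows "box_mass F (cbox a b) = (\<Prod>m\<in>UNIV. F m (b $ m) - F m (a $ m))"
proof -
  have "cbox a b \<noteq> {}" using assms by (simp add: cbox_eq_empty_vec not_less)
  then show ?thesis by (simp add: box_mass_def interval_bounds_cbox_vec[OF assms])
qed

lemma box_mass_empty [simp]: "box_mass F {} = 0"
  by (simp add: box_mass_def)

text \<open>A cut through the box perpendicular to axis \<open>k\<close> changes only the
  \<open>k\<close>-th factor, and that factor telescopes through \<open>F k c\<close>. A cut missing
  the box leaves one empty piece, of mass 0.\<close>

lemma box_mass_split:
  fixes a b :: "real ^ 'd"
  shows "box_mass F (cbox a b) = box_mass F (cbox a b \<inter> {x. x $ k \<le> c}) + box_mass F (cbox a b \<inter> {x. x $ k \<ge> c})"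
proof (cases "cbox a b = {}")
  case False
  then have ab: "a $ m \<le> b $ m" for m by (simp add: cbox_eq_empty_vec not_less)
  consider "c < a $ k" | "b $ k < c" | "a $ k \<le> c" "c \<le> b $ k" by linarith
  then show ?thesis
  proof cases
    case 1
    then have "x $ k > c" if "x \<in> cbox a b" for x
      using that by (force simp: mem_box_cart dest: spec[of _ k])
    then have "cbox a b \<inter> {x. x $ k \<le> c} = {}" "cbox a b \<inter> {x. x $ k \<ge> c} = cbox a b"
      by (auto simp: less_imp_le not_le[symmetric])
    then show ?thesis by simp
  next
    case 2
    then have "x $ k < c" if "x \<in> cbox a b" for x
      using that by (force simp: mem_box_cart dest: spec[of _ k])
    then have "cbox a b \<inter> {x. x $ k \<ge> c} = {}" "cbox a b \<inter> {x. x $ k \<le> c} = cbox a b"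
      by (auto simp: less_imp_le not_le[symmetric])
    then show ?thesis by simp
  next
    case 3
    define b' where "b' = (\<chi> m. if m = k then c else b $ m)"
    define a' where "a' = (\<chi> m. if m = k then c else a $ m)"
    have b': "b' $ m \<le> b $ m" and a': "a $ m \<le> a' $ m" for m
      using 3 by (auto simp: a'_def b'_def)
    have l: "cbox a b \<inter> {x. x $ k \<le> c} = cbox a b'"
    proof (intro equalityI subsetI)
      fix x assume "x \<in> cbox a b \<inter> {x. x $ k \<le> c}"
      then show "x \<in> cbox a b'" by (simp add: mem_box_cart b'_def)
    next
      fix x assume x: "x \<in> cbox a b'"
      then have "x $ m \<le> b' $ m" for m by (simp add: mem_box_cart)
      from this[of k] order_trans[OF this b'] x show "x \<in> cbox a b \<inter> {x. x $ k \<le> c}"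
        by (simp add: mem_box_cart b'_def)
    qed
    have r: "cbox a b \<inter> {x. x $ k \<ge> c} = cbox a' b"
    proof (intro equalityI subsetI)
      fix x assume "x \<in> cbox a b \<inter> {x. x $ k \<ge> c}"
      then show "x \<in> cbox a' b" by (simp add: mem_box_cart a'_def)
    next
      fix x assume x: "x \<in> cbox a' b"
      then have "a' $ m \<le> x $ m" for m by (simp add: mem_box_cart)
      from this[of k] order_trans[OF a' this] x show "x \<in> cbox a b \<inter> {x. x $ k \<ge> c}"
        by (simp add: mem_box_cart a'_def)
    qed
    define P where "P = (\<Prod>m\<in>UNIV - {k}. F m (b $ m) - F m (a $ m))"
    have U: "(\<Prod>m\<in>UNIV. f m) = f k * (\<Prod>m\<in>UNIV - {k}. f m)" for f :: "'d \<Rightarrow> real"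
      by (rule prod.remove) auto
    have "(\<Prod>m\<in>UNIV - {k}. F m (b' $ m) - F m (a $ m)) = P"
         "(\<Prod>m\<in>UNIV - {k}. F m (b $ m) - F m (a' $ m)) = P"
      unfolding P_def by (rule prod.cong; simp add: a'_def b'_def)+
    moreover have "a $ m \<le> b' $ m" "a' $ m \<le> b $ m" for m
      using ab 3 by (auto simp: a'_def b'_def)
    ultimately have "box_mass F (cbox a b') = (F k c - F k (a $ k)) * P"
      "box_mass F (cbox a' b) = (F k (b $ k) - F k c) * P"
      using U[of "\<lambda>m. F m (b' $ m) - F m (a $ m)"] U[of "\<lambda>m. F m (b $ m) - F m (a' $ m)"]
      by (simp_all add: box_mass_cbox, simp_all add: a'_def b'_def)
    moreover have "box_mass F (cbox a b) = (F k (b $ k) - F k (a $ k)) * P"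
      using U[of "\<lambda>m. F m (b $ m) - F m (a $ m)"] by (simp add: box_mass_cbox[OF ab] P_def)
    ultimately show ?thesis
      unfolding l r by (simp add: left_diff_distrib)
  qed
qed simp

lemma box_mass_degenerate:
  fixes a b :: "real ^ 'd"
  assumes "box a b = {}"
  shows "box_mass F (cbox a b) = 0"
proof (cases "cbox a b = {}")
  case False
  then have ab: "a $ m \<le> b $ m" for m by (simp add: cbox_eq_empty_vec not_less)
  obtain m where "b $ m \<le> a $ m" using assms by (auto simp: cbox_eq_empty_vec)
  with ab[of m] have "F m (b $ m) - F m (a $ m) = 0" by (simp add: antisym)
  then show ?thesis unfolding box_mass_cbox[OF ab] by (intro prod_zero) auto
qed simp

text \<open>Vanishing on boxes with empty interior and additivity under a hyperplane cut are the
  axioms of \<open>operative\<close>, which extends additivity to arbitrary finite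
  divisions.\<close>

lemma operative_box_mass: "operative (+) 0 (box_mass F :: (real ^ 'd) set \<Rightarrow> real)"
proof
  show "box_mass F (cbox a b) = 0" if "box a b = {}" for a b :: "real ^ 'd"
    using that by (rule box_mass_degenerate)
  show "box_mass F (cbox a b) = box_mass F (cbox a b \<inter> {x. x \<bullet> k \<le> c}) + box_mass F (cbox a b \<inter> {x. c \<le> x \<bullet> k})"
    if k: "k \<in> Basis" for a b :: "real ^ 'd" and c k
  proof -
    obtain m :: 'd where "k = axis m 1" using k by (auto simp: Basis_vec_def)
    then show ?thesis using box_mass_split[of F a b m c] by (simp add: inner_axis)
  qed
qed

text \<open>The tiles form a division in the sense of \<open>division_of\<close>, so the operative
  set function sums over them. The functions \<open>F m\<close> are arbitrary; a discontinuous
  choice is used below.\<close>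

lemma box_mass_tiling:
  fixes a b :: "'k \<Rightarrow> real ^ 'd" and A B :: "real ^ 'd" and F :: "'d \<Rightarrow> real \<Rightarrow> real"
  assumes til: "tiling I (\<lambda>k. cbox (a k) (b k)) (cbox A B)"
    and ab: "\<And>k m. k \<in> I \<Longrightarrow> a k $ m < b k $ m" and AB: "\<And>m. A $ m < B $ m"
  shows "(\<Sum>k\<in>I. \<Prod>m\<in>UNIV. F m (b k $ m) - F m (a k $ m)) = (\<Prod>m\<in>UNIV. F m (B $ m) - F m (A $ m))"
proof -
  let ?T = "\<lambda>k. cbox (a k) (b k)"
  have fin: "finite I" and U: "(\<Union>k\<in>I. ?T k) = cbox A B"
    and dis: "disjoint_family_on (\<lambda>k. interior (?T k)) I"
    using til by (auto simp: tiling_def)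
  have ne: "interior (?T k) \<noteq> {}" if "k \<in> I" for k
    using ab[OF that] by (auto simp: interior_cbox cbox_eq_empty_vec not_le)
  have disj: "interior (?T k) \<inter> interior (?T k') = {}" if "k \<in> I" "k' \<in> I" "k \<noteq> k'" for k k'
    using dis that by (auto simp: disjoint_family_on_def)
  \<comment> \<open>A division is a set of boxes, so the sum over tiles must be reindexed. Two
    indices with the same tile would have equal, nonempty and disjoint interiors.\<close>
  have inj: "inj_on ?T I"
    using disj ne by (intro inj_onI) (metis Int_absorb)
  have "?T ` I division_of cbox A B"
    unfolding division_of_def
  proof (intro conjI ballI impI)
    fix K assume "K \<in> ?T ` I"
    then obtain k where k: "k \<in> I" "K = ?T k" by blast
    then show "K \<subseteq> cbox A B" "\<exists>a b. K = cbox a b" using U by auto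
    show "K \<noteq> {}" using ne[OF k(1)] k(2) interior_empty by metis
  next
    fix K K' assume "K \<in> ?T ` I" "K' \<in> ?T ` I" "K \<noteq> K'"
    then obtain k k' where "k \<in> I" "k' \<in> I" "k \<noteq> k'" "K = ?T k" "K' = ?T k'" by blast
    then show "interior K \<inter> interior K' = {}" using disj by blast
  next
    show "finite (?T ` I)" using fin by simp
    show "\<Union> (?T ` I) = cbox A B" by (fact U)
  qed
  from operative.division[OF operative_box_mass[of F] this]
  have "(\<Sum>K\<in>?T ` I. box_mass F K) = box_mass F (cbox A B)"
    by (simp add: sum_def)
  then show ?thesis
    using ab AB by (simp add: sum.reindex[OF inj] box_mass_cbox less_imp_le)
qed

section \<open>Rigidity: functions on face coordinates\<close>

text \<open>Let \<open>F m\<close> be the indicator of the coordinate \<open>p\<close> of the face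
  and the other functions the identity. The big box has mass 0, as \<open>p\<close> lies strictly
  inside its range. If no tile ended at \<open>p\<close>, no tile would have positive mass, while
  tile \<open>k\<close> has negative mass.\<close>

lemma tile_lower_face_is_upper_face:
  fixes a b :: "'k \<Rightarrow> real ^ 'd" and A B :: "real ^ 'd"
  assumes til: "tiling I (\<lambda>k. cbox (a k) (b k)) (cbox A B)"
    and ab: "\<And>k m. k \<in> I \<Longrightarrow> a k $ m < b k $ m" and AB: "\<And>m. A $ m < B $ m"
    and k: "k \<in> I" and ne: "a k $ m \<noteq> A $ m"
  shows "\<exists>k'\<in>I. b k' $ m = a k $ m"
proof (rule ccontr)
  assume none: "\<not> (\<exists>k'\<in>I. b k' $ m = a k $ m)"
  define p where "p = a k $ m"
  define F where "F = (\<lambda>m' x. if m' = m then if x = p then 1 else 0 else x :: real)"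
  define W where "W = (\<lambda>k'. \<Prod>m'\<in>UNIV - {m}. b k' $ m' - a k' $ m')"
  have fin: "finite I" using til by (simp add: tiling_def)
  have U: "(\<Prod>m'\<in>UNIV. F m' (v $ m') - F m' (u $ m'))
      = ((if v $ m = p then 1 else 0) - (if u $ m = p then 1 else 0)) * (\<Prod>m'\<in>UNIV - {m}. v $ m' - u $ m')"
    for u v :: "real ^ 'd"
  proof -
    have "(\<Prod>m'\<in>UNIV - {m}. F m' (v $ m') - F m' (u $ m')) = (\<Prod>m'\<in>UNIV - {m}. v $ m' - u $ m')"
      by (rule prod.cong) (auto simp: F_def)
    then show ?thesis
      using prod.remove[of UNIV m "\<lambda>m'. F m' (v $ m') - F m' (u $ m')"] by (simp add: F_def)
  qed
  have W: "W k' > 0" if "k' \<in> I" for k'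
    unfolding W_def using ab[OF that] by (intro prod_pos) simp
  \<comment> \<open>Containment of the tile yields \<open>p < B $ m\<close>, so the indicator
    vanishes at the upper end of the big box as well.\<close>
  have "cbox (a k) (b k) \<subseteq> cbox A B" using til k by (auto simp: tiling_def)
  moreover have "b k \<in> cbox (a k) (b k)" using ab[OF k] by (simp add: mem_box_cart less_imp_le)
  ultimately have "b k \<in> cbox A B" by (rule subsetD)
  then have "b k $ m \<le> B $ m" by (simp add: mem_box_cart)
  then have "p < B $ m" using ab[OF k, of m] by (simp add: p_def)
  then have "(\<Prod>m'\<in>UNIV. F m' (B $ m') - F m' (A $ m')) = 0"
    unfolding U using ne by (simp add: p_def)
  then have "(\<Sum>k'\<in>I. \<Prod>m'\<in>UNIV. F m' (b k' $ m') - F m' (a k' $ m')) = 0"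
    using box_mass_tiling[OF til ab AB, of F] by simp
  moreover have "(\<Prod>m'\<in>UNIV. F m' (b k' $ m') - F m' (a k' $ m')) = - (if a k' $ m = p then W k' else 0)"
    if "k' \<in> I" for k'
    unfolding U using none that by (simp add: p_def W_def)
  ultimately have "(\<Sum>k'\<in>I. if a k' $ m = p then W k' else 0) = 0"
    by (simp add: sum_negf)
  moreover have "(\<Sum>k'\<in>I. if a k' $ m = p then W k' else 0) > 0"
    using fin k W by (intro sum_pos2[of _ k]) (auto simp: p_def less_imp_le)
  ultimately show False by simp
qed

text \<open>Unless a lower face lies at \<open>A $ m\<close>, some tile ends there. Crossing that
  tile leaves \<open>f\<close> unchanged and leads to a strictly lower face, so after finitely many
  steps the descent reaches \<open>A $ m\<close>.\<close>

lemma constant_on_tile_faces: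
  fixes a b :: "'k \<Rightarrow> real ^ 'd" and A B :: "real ^ 'd" and f :: "real \<Rightarrow> real"
  assumes til: "tiling I (\<lambda>k. cbox (a k) (b k)) (cbox A B)"
    and ab: "\<And>k m. k \<in> I \<Longrightarrow> a k $ m < b k $ m" and AB: "\<And>m. A $ m < B $ m"
    and f: "\<And>k. k \<in> I \<Longrightarrow> f (b k $ m) = f (a k $ m)"
    and k: "k \<in> I"
  shows "f (a k $ m) = f (A $ m)"
proof -
  have "finite ((\<lambda>k. a k $ m) ` I)" using til by (simp add: tiling_def)
  then have "\<forall>k\<in>I. a k $ m = p \<longrightarrow> f p = f (A $ m)" for p
  proof (induction "card {x \<in> (\<lambda>k. a k $ m) ` I. x < p}" arbitrary: p rule: less_induct)
    case less
    show ?case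
    proof (intro ballI impI)
      fix k assume k: "k \<in> I" "a k $ m = p"
      show "f p = f (A $ m)"
      proof (cases "p = A $ m")
        case False
        then obtain k' where k': "k' \<in> I" "b k' $ m = p"
          using tile_lower_face_is_upper_face[OF til ab AB k(1)] k(2) by auto
        then have lt: "a k' $ m < p" using ab by auto
        \<comment> \<open>The induction counts the lower-face coordinates below \<open>p\<close>.
          The new coordinate is below \<open>p\<close> but not below itself, so the count
          drops.\<close>
        have "a k' $ m \<in> {x \<in> (\<lambda>k. a k $ m) ` I. x < p} - {x \<in> (\<lambda>k. a k $ m) ` I. x < a k' $ m}"
          using lt k'(1) by simp
        then have "card {x \<in> (\<lambda>k. a k $ m) ` I. x < a k' $ m} < card {x \<in> (\<lambda>k. a k $ m) ` I. x < p}"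
          using less.prems lt by (intro psubset_card_mono psubsetI) auto
        from less.hyps[OF this less.prems] k'(1) have "f (a k' $ m) = f (A $ m)" by blast
        then show ?thesis using f[OF k'(1)] k'(2) by simp
      qed simp
    qed
  qed
  then show ?thesis using k by blast
qed

text \<open>The increments in directions \<open>i\<close> and \<open>j\<close> share the factor
  \<open>w k\<close>, so their product contains its square and every tile has nonnegative mass. The
  total is 0 because \<open>f\<close> agrees at both ends of side \<open>i\<close>; hence every term
  vanishes.\<close>

lemma sum_tiling_increments_zero:
  fixes a b :: "'k \<Rightarrow> real ^ 'd" and A B :: "real ^ 'd" and f g :: "real \<Rightarrow> real"
  assumes til: "tiling I (\<lambda>k. cbox (a k) (b k)) (cbox A B)"
    and ab: "\<And>k m. k \<in> I \<Longrightarrow> a k $ m < b k $ m" and AB: "\<And>m. A $ m < B $ m"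
    and ij: "j \<noteq> i"
    and pr: "\<And>k. k \<in> I \<Longrightarrow> 0 < p k" "\<And>k. k \<in> I \<Longrightarrow> 0 < r k"
    and f: "\<And>k. k \<in> I \<Longrightarrow> f (b k $ i) - f (a k $ i) = p k * w k"
    and g: "\<And>k. k \<in> I \<Longrightarrow> g (b k $ j) - g (a k $ j) = r k * w k"
    and fAB: "f (B $ i) = f (A $ i)" and k: "k \<in> I"
  shows "w k = 0"
proof -
  define F where "F = (\<lambda>m x. if m = i then f x else if m = j then g x else x)"
  define W where "W = (\<lambda>k. \<Prod>m\<in>UNIV - {i} - {j}. b k $ m - a k $ m)"
  have fin: "finite I" using til by (simp add: tiling_def)
  have W: "W k > 0" if "k \<in> I" for k
    unfolding W_def using ab[OF that] by (intro prod_pos) simp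
  have tile: "(\<Prod>m\<in>UNIV. F m (b k $ m) - F m (a k $ m)) = p k * r k * (w k)\<^sup>2 * W k" if k: "k \<in> I" for k
  proof -
    have "(\<Prod>m\<in>UNIV - {i} - {j}. F m (b k $ m) - F m (a k $ m)) = W k"
      unfolding W_def by (rule prod.cong) (auto simp: F_def)
    moreover have "(\<Prod>m\<in>UNIV. F m (b k $ m) - F m (a k $ m)) =
        (F i (b k $ i) - F i (a k $ i)) * ((F j (b k $ j) - F j (a k $ j)) *
        (\<Prod>m\<in>UNIV - {i} - {j}. F m (b k $ m) - F m (a k $ m)))"
      using ij by (subst prod.remove[of UNIV i], simp, simp, subst prod.remove[of "UNIV - {i}" j]) simp_all
    ultimately show ?thesis
      using ij f[OF k] g[OF k] by (simp add: F_def power2_eq_square)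
  qed
  have "(\<Prod>m\<in>UNIV. F m (B $ m) - F m (A $ m)) = 0"
    using fAB by (intro prod_zero bexI[of _ i]) (simp_all add: F_def)
  then have "(\<Sum>k\<in>I. p k * r k * (w k)\<^sup>2 * W k) = 0"
    using box_mass_tiling[OF til ab AB, of F] tile by simp
  moreover have "0 \<le> p k * r k * (w k)\<^sup>2 * W k" if "k \<in> I" for k
    using pr[OF that] W[OF that] by simp
  ultimately have "p k * r k * (w k)\<^sup>2 * W k = 0"
    using sum_nonneg_eq_0_iff[OF fin, of "\<lambda>k. p k * r k * (w k)\<^sup>2 * W k"] k by blast
  then show ?thesis using pr[OF k] W[OF k] by simp
qed

section \<open>The linear system of a tiling\<close>

text \<open>This evaluates the face part of a row of the system. An endpoint outside
  \<open>X\<close> contributes 0, which is how the value at the lower face of the big box is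
  normalised to 0.\<close>

lemma sum_endpoint_difference:
  fixes h :: "real \<Rightarrow> real"
  assumes "finite X"
  shows "(\<Sum>x\<in>X. (of_bool (v = x) - of_bool (u = x)) * h x)
    = (if v \<in> X then h v else 0) - (if u \<in> X then h u else 0)"
proof -
  have eq: "(of_bool (v = x) - of_bool (u = x)) * h x = (if x = v then h v else 0) - (if x = u then h u else 0)" for x
    by auto
  show ?thesis unfolding eq sum_subtractf using assms by (simp add: sum.delta)
qed

lemma sum_abs_endpoint_difference_le:
  assumes "finite X"
  shows "(\<Sum>x\<in>X. \<bar>of_bool (v = x) - of_bool (u = x) :: real\<bar>) \<le> 2"
proof -
  have "(\<Sum>x\<in>X. \<bar>of_bool (v = x) - of_bool (u = x) :: real\<bar>) \<le> (\<Sum>x\<in>X. (if x = v then 1 else 0) + (if x = u then 1 else 0))"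
    by (rule sum_mono) auto
  also have "\<dots> \<le> 2"
    unfolding sum.distrib using assms by (simp add: sum.delta)
  finally show ?thesis .
qed

lemma tiling_integer_scaling:
  fixes a b :: "'k \<Rightarrow> real ^ 'd" and A B :: "real ^ 'd" and p r :: "'k \<Rightarrow> nat" and c :: "'k \<Rightarrow> real"
  assumes til: "tiling I (\<lambda>k. cbox (a k) (b k)) (cbox A B)"
    and ab: "\<And>k m. k \<in> I \<Longrightarrow> a k $ m < b k $ m" and AB: "\<And>m. A $ m < B $ m"
    and ij: "j \<noteq> i"
    and pr: "\<And>k. k \<in> I \<Longrightarrow> 0 < p k" "\<And>k. k \<in> I \<Longrightarrow> 0 < r k"
    and p: "\<And>k. k \<in> I \<Longrightarrow> b k $ i - a k $ i = c k * real (p k)"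
    and r: "\<And>k. k \<in> I \<Longrightarrow> b k $ j - a k $ j = c k * real (r k)"
  shows "\<exists>l>0. l * (B $ i - A $ i) \<le> 8 ^ card I * (\<Prod>k\<in>I. real (max (p k) (r k))) \<and> (\<forall>k\<in>I. l * c k \<in> \<int>)"
proof -
  \<comment> \<open>The lower faces of the big box are removed from the unknowns, their values being
    fixed to 0. The coordinate \<open>B $ i\<close> is inserted explicitly, since its column is the
    distinguished one.\<close>
  define X where "X = insert (B $ i) ((\<lambda>k. a k $ i) ` I \<union> (\<lambda>k. b k $ i) ` I) - {A $ i}"
  define Y where "Y = (\<lambda>k. a k $ j) ` I \<union> (\<lambda>k. b k $ j) ` I - {A $ j}"
  define V where "V = X <+> (Y <+> I)"
  \<comment> \<open>Row \<open>Inl k\<close> is the equation of tile \<open>k\<close> in direction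
    \<open>i\<close>, row \<open>Inr k\<close> the one in direction \<open>j\<close>. Columns are
    faces in direction \<open>i\<close>, faces in direction \<open>j\<close>, and tile
    factors.\<close>
  define M :: "'k + 'k \<Rightarrow> real + (real + 'k) \<Rightarrow> real" where
    "M = (\<lambda>e v. case e of
        Inl k \<Rightarrow> (case v of Inl x \<Rightarrow> of_bool (b k $ i = x) - of_bool (a k $ i = x)
          | Inr (Inl y) \<Rightarrow> 0 | Inr (Inr k') \<Rightarrow> if k' = k then - real (p k) else 0)
      | Inr k \<Rightarrow> (case v of Inl x \<Rightarrow> 0 | Inr (Inl y) \<Rightarrow> of_bool (b k $ j = y) - of_bool (a k $ j = y)
          | Inr (Inr k') \<Rightarrow> if k' = k then - real (r k) else 0))"
  define z :: "real + (real + 'k) \<Rightarrow> real" where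
    "z = (\<lambda>v. case v of Inl x \<Rightarrow> x - A $ i | Inr (Inl y) \<Rightarrow> y - A $ j | Inr (Inr k) \<Rightarrow> c k)"
  \<comment> \<open>With this weight the column of tile \<open>k\<close> contributes at most 2 to
    either row of that tile, like the two face entries together.\<close>
  define t :: "real + (real + 'k) \<Rightarrow> real" where
    "t = (\<lambda>v. case v of Inl x \<Rightarrow> 1 | Inr (Inl y) \<Rightarrow> 1 | Inr (Inr k) \<Rightarrow> 2 / real (max (p k) (r k)))"
  have fin: "finite I" using til by (simp add: tiling_def)
  then have finX: "finite X" and finY: "finite Y" by (simp_all add: X_def Y_def)
  have finV: "finite V" using fin finX finY by (simp add: V_def)
  have sumV: "sum h V = (\<Sum>x\<in>X. h (Inl x)) + ((\<Sum>y\<in>Y. h (Inr (Inl y))) + (\<Sum>k\<in>I. h (Inr (Inr k))))"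
    for h :: "real + (real + 'k) \<Rightarrow> real"
    using fin finX finY by (simp add: V_def sum.Plus)
  define f :: "(real + (real + 'k) \<Rightarrow> real) \<Rightarrow> real \<Rightarrow> real"
    where "f = (\<lambda>w x. if x \<in> X then w (Inl x) else 0)"
  define g :: "(real + (real + 'k) \<Rightarrow> real) \<Rightarrow> real \<Rightarrow> real"
    where "g = (\<lambda>w y. if y \<in> Y then w (Inr (Inl y)) else 0)"
  have row_i: "(\<Sum>v\<in>V. M (Inl k) v * w v) = f w (b k $ i) - f w (a k $ i) - real (p k) * w (Inr (Inr k))"
    if "k \<in> I" for k w
  proof -
    have "(\<Sum>k'\<in>I. (if k' = k then - real (p k) else 0) * w (Inr (Inr k'))) = - real (p k) * w (Inr (Inr k))"
      using sum.delta[OF fin, of k "\<lambda>k'. - real (p k) * w (Inr (Inr k'))"] that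
      by (simp add: if_distrib[of "\<lambda>x. x * _"] cong: if_cong)
    then show ?thesis
      unfolding sumV M_def f_def using sum_endpoint_difference[OF finX, of "b k $ i" "a k $ i" "\<lambda>x. w (Inl x)"] by simp
  qed
  have row_j: "(\<Sum>v\<in>V. M (Inr k) v * w v) = g w (b k $ j) - g w (a k $ j) - real (r k) * w (Inr (Inr k))"
    if "k \<in> I" for k w
  proof -
    have "(\<Sum>k'\<in>I. (if k' = k then - real (r k) else 0) * w (Inr (Inr k'))) = - real (r k) * w (Inr (Inr k))"
      using sum.delta[OF fin, of k "\<lambda>k'. - real (r k) * w (Inr (Inr k'))"] that
      by (simp add: if_distrib[of "\<lambda>x. x * _"] cong: if_cong)
    then show ?thesis
      unfolding sumV M_def g_def using sum_endpoint_difference[OF finY, of "b k $ j" "a k $ j" "\<lambda>y. w (Inr (Inl y))"] by simp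
  qed
  \<comment> \<open>For a face lying on the lower side of the big box, the default value 0 coincides
    with the difference on the right.\<close>
  have fz: "f z (b k $ i) = b k $ i - A $ i" "f z (a k $ i) = a k $ i - A $ i"
    and gz: "g z (b k $ j) = b k $ j - A $ j" "g z (a k $ j) = a k $ j - A $ j" if "k \<in> I" for k
    using that by (auto simp: f_def g_def z_def X_def Y_def)
  have v0: "Inl (B $ i) \<in> V" using AB[of i] by (auto simp: V_def X_def)
  have "\<exists>l. l \<noteq> 0 \<and> (\<forall>v\<in>V. l * z v \<in> \<int>) \<and> \<bar>l * z (Inl (B $ i))\<bar> * (\<Prod>v\<in>V - {Inl (B $ i)}. t v) \<le> 4 ^ card (I <+> I)"
  proof (rule kernel_vector_integer_multiple[where A = M])
    show "M e v \<in> \<int>" if "e \<in> I <+> I" "v \<in> V" for e v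
      by (auto simp: M_def split: sum.splits)
    show "(\<Sum>v\<in>V. M e v * z v) = 0" if "e \<in> I <+> I" for e
      using that
    proof (rule PlusE)
      fix k assume "k \<in> I" "e = Inl k"
      then show ?thesis using p[of k] by (simp add: row_i fz) (simp add: z_def)
    next
      fix k assume "k \<in> I" "e = Inr k"
      then show ?thesis using r[of k] by (simp add: row_j gz) (simp add: z_def)
    qed
    show "z (Inl (B $ i)) \<noteq> 0" using AB[of i] by (simp add: z_def)
    show "0 \<le> t v" for v by (auto simp: t_def split: sum.splits)
    show "(\<Sum>v\<in>V - {Inl (B $ i)}. \<bar>M e v\<bar> * t v) \<le> 4" if "e \<in> I <+> I" for e
    proof -
      \<comment> \<open>The bound 4 holds even with the distinguished column included: at most 2
        from the faces and at most 2 from the tile factor.\<close>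
      have "(\<Sum>v\<in>V - {Inl (B $ i)}. \<bar>M e v\<bar> * t v) \<le> (\<Sum>v\<in>V. \<bar>M e v\<bar> * t v)"
        using finV by (intro sum_mono2) (auto simp: t_def split: sum.splits)
      also have "\<dots> \<le> 4"
        using that
      proof (rule PlusE)
        fix k assume k: "k \<in> I" and e: "e = Inl k"
        have "(\<Sum>k'\<in>I. \<bar>M e (Inr (Inr k'))\<bar> * t (Inr (Inr k'))) = (\<Sum>k'\<in>I. if k' = k then real (p k) * t (Inr (Inr k)) else 0)"
          by (rule sum.cong) (auto simp: e M_def)
        also have "\<dots> = real (p k) * (2 / real (max (p k) (r k)))"
          using k fin by (simp add: t_def)
        also have "\<dots> \<le> 2" using pr[OF k] by (simp add: divide_le_eq)
        finally have "(\<Sum>k'\<in>I. \<bar>M e (Inr (Inr k'))\<bar> * t (Inr (Inr k'))) \<le> 2" .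
        moreover have "(\<Sum>y\<in>Y. \<bar>M e (Inr (Inl y))\<bar> * t (Inr (Inl y))) = 0" by (simp add: e M_def)
        moreover have "(\<Sum>x\<in>X. \<bar>M e (Inl x)\<bar> * t (Inl x)) \<le> 2"
          using sum_abs_endpoint_difference_le[OF finX] by (simp add: e M_def t_def)
        ultimately show ?thesis unfolding sumV by linarith
      next
        fix k assume k: "k \<in> I" and e: "e = Inr k"
        have "(\<Sum>k'\<in>I. \<bar>M e (Inr (Inr k'))\<bar> * t (Inr (Inr k'))) = (\<Sum>k'\<in>I. if k' = k then real (r k) * t (Inr (Inr k)) else 0)"
          by (rule sum.cong) (auto simp: e M_def)
        also have "\<dots> = real (r k) * (2 / real (max (p k) (r k)))"
          using k fin by (simp add: t_def)
        also have "\<dots> \<le> 2" using pr[OF k] by (simp add: divide_le_eq)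
        finally have "(\<Sum>k'\<in>I. \<bar>M e (Inr (Inr k'))\<bar> * t (Inr (Inr k'))) \<le> 2" .
        moreover have "(\<Sum>x\<in>X. \<bar>M e (Inl x)\<bar> * t (Inl x)) = 0" by (simp add: e M_def)
        moreover have "(\<Sum>y\<in>Y. \<bar>M e (Inr (Inl y))\<bar> * t (Inr (Inl y))) \<le> 2"
          using sum_abs_endpoint_difference_le[OF finY] by (simp add: e M_def t_def)
        ultimately show ?thesis unfolding sumV by linarith
      qed
      finally show ?thesis .
    qed
    \<comment> \<open>Vanishing at \<open>B $ i\<close> makes \<open>f w\<close> agree at both ends
      of the big side, so all tile factors are 0. Then \<open>f w\<close> and \<open>g w\<close> do
      not change across any tile, and being 0 at the lower side they vanish at all faces.\<close>
    show "w v = 0" if ker: "\<And>e. e \<in> I <+> I \<Longrightarrow> (\<Sum>v\<in>V. M e v * w v) = 0" and w0: "w (Inl (B $ i)) = 0"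
      and v: "v \<in> V" for w v
    proof -
      have fw: "f w (b k $ i) - f w (a k $ i) = real (p k) * w (Inr (Inr k))"
        and gw: "g w (b k $ j) - g w (a k $ j) = real (r k) * w (Inr (Inr k))" if "k \<in> I" for k
        using ker[of "Inl k"] ker[of "Inr k"] that by (simp_all add: row_i row_j InlI InrI)
      have A0: "f w (A $ i) = 0" "g w (A $ j) = 0" by (simp_all add: f_def g_def X_def Y_def)
      have B0: "f w (B $ i) = f w (A $ i)" using w0 A0 by (simp add: f_def)
      have c0: "w (Inr (Inr k)) = 0" if "k \<in> I" for k
        by (rule sum_tiling_increments_zero[OF til ab AB ij _ _ fw gw B0 that]) (simp_all add: pr)
      have fk: "f w (b k $ i) = f w (a k $ i)" and gk: "g w (b k $ j) = g w (a k $ j)" if "k \<in> I" for k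
        using fw[OF that] gw[OF that] c0[OF that] by simp_all
      have fa: "f w (a k $ i) = 0" and ga: "g w (a k $ j) = 0" if "k \<in> I" for k
        using constant_on_tile_faces[OF til ab AB fk that] constant_on_tile_faces[OF til ab AB gk that] A0 by simp_all
      have "f w x = 0" if "x \<in> X" for x
        using that fa fk B0 A0 by (auto simp: X_def)
      moreover have "g w y = 0" if "y \<in> Y" for y
        using that ga gk by (auto simp: Y_def)
      ultimately show ?thesis
        using v c0 by (auto simp: V_def f_def g_def)
    qed
  qed (use fin finV v0 in simp_all)
  then obtain l where l: "l \<noteq> 0" "\<And>v. v \<in> V \<Longrightarrow> l * z v \<in> \<int>"
    and le: "\<bar>l * z (Inl (B $ i))\<bar> * (\<Prod>v\<in>V - {Inl (B $ i)}. t v) \<le> 4 ^ card (I <+> I)" by blast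
  define Q where "Q = (\<Prod>k\<in>I. real (max (p k) (r k)))"
  have Q: "Q > 0" unfolding Q_def using pr by (intro prod_pos) (simp add: less_max_iff_disj)
  have "V - {Inl (B $ i)} = (X - {B $ i}) <+> (Y <+> I)" by (auto simp: V_def)
  then have "(\<Prod>v\<in>V - {Inl (B $ i)}. t v) = (\<Prod>k\<in>I. 2 / real (max (p k) (r k)))"
    using fin finX finY by (simp add: prod.Plus t_def)
  also have "\<dots> = 2 ^ card I / Q" by (simp add: prod_dividef Q_def)
  \<comment> \<open>There are \<open>2 * card I\<close> rows of weighted norm at most 4, which gives
    the base 16; the weights take back a factor 2 per tile, leaving 8.\<close>
  finally have "\<bar>l\<bar> * (B $ i - A $ i) * (2 ^ card I / Q) \<le> 16 ^ card I"
    using le AB[of i] fin by (simp add: z_def abs_mult card_Plus power_add flip: power_mult_distrib)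
  moreover have "(16 :: real) ^ card I = 8 ^ card I * 2 ^ card I" by (simp flip: power_mult_distrib)
  ultimately have "(2 ^ card I / Q) * (\<bar>l\<bar> * (B $ i - A $ i)) \<le> (2 ^ card I / Q) * (8 ^ card I * Q)"
    using Q by (simp add: mult.commute)
  then have "\<bar>l\<bar> * (B $ i - A $ i) \<le> 8 ^ card I * Q"
    by (rule mult_left_le_imp_le) (use Q in simp)
  \<comment> \<open>The multiplier \<open>l\<close> may be negative; passing to its absolute value
    changes at most the sign of the integer \<open>l * c k\<close>.\<close>
  moreover have "\<bar>l\<bar> * c k \<in> \<int>" if "k \<in> I" for k
    using l(2)[of "Inr (Inr k)"] that by (auto simp: V_def z_def abs_if)
  ultimately show ?thesis using l(1) by (intro exI[of _ "\<bar>l\<bar>"]) (simp add: Q_def)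
qed

section \<open>Scaling hypercuboids and the bound on the longest side\<close>

lemma hypercuboid_eq_cbox:
  assumes "hypercuboid S"
  shows "S = cbox (interval_lowerbound S) (interval_upperbound S)"
    and "interval_lowerbound S $ m < interval_upperbound S $ m"
proof -
  obtain a b where "\<And>m. a $ m < b $ m" "S = cbox a b" using assms by (auto simp: hypercuboid_def)
  then show "S = cbox (interval_lowerbound S) (interval_upperbound S)"
    "interval_lowerbound S $ m < interval_upperbound S $ m"
    by (simp_all add: interval_bounds_cbox_vec less_imp_le)
qed

lemma side_length_scaleR:
  fixes S :: "(real ^ 'd) set"
  assumes "hypercuboid S" "l > 0"
  shows "side_length ((\<lambda>x. l *\<^sub>R x) ` S) m = l * side_length S m"
proof -
  obtain a b where ab: "\<And>m. a $ m < b $ m" and S: "S = cbox a b"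
    using assms(1) by (auto simp: hypercuboid_def)
  have "cbox a b \<noteq> {}" using ab by (simp add: cbox_eq_empty_vec not_less less_imp_le)
  then have "(\<lambda>x. l *\<^sub>R x) ` S = cbox (l *\<^sub>R a) (l *\<^sub>R b)"
    using assms(2) by (simp add: S image_smult_cbox)
  then show ?thesis
    using ab assms(2) by (simp add: S side_length_cbox right_diff_distrib)
qed

theorem theorem6p2:
  fixes R :: "(real ^ 'd) set"
    and n :: nat
    and C :: "nat \<Rightarrow> (real ^ 'd) set"
    and q :: "nat \<Rightarrow> 'd \<Rightarrow> nat"
    and c :: "nat \<Rightarrow> real"
    and i j :: 'd
  assumes "CARD('d) \<ge> 2"
    and "hypercuboid R"
    and "\<And>k. k \<in> {1..n} \<Longrightarrow> hypercuboid (C k)"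
    and "tiling {1..n} C R"
    and "\<And>k m. k \<in> {1..n} \<Longrightarrow> q k m > 0"
    and "\<And>k. k \<in> {1..n} \<Longrightarrow> c k > 0"
    and "\<And>k m. k \<in> {1..n} \<Longrightarrow> side_length (C k) m = c k * real (q k m)"
    and "side_length R i = longest_side R"
    and "j \<noteq> i"
  shows "\<exists>l::real. l > 0 \<and>
           longest_side ((\<lambda>x. l *\<^sub>R x) ` R) \<le> 8 ^ n * (\<Prod>k=1..n. real (max (q k i) (q k j))) \<and>
           (\<forall>k\<in>{1..n}. \<forall>m. side_length ((\<lambda>x. l *\<^sub>R x) ` C k) m \<in> \<int>)"
proof -
  let ?a = "\<lambda>k. interval_lowerbound (C k)" and ?b = "\<lambda>k. interval_upperbound (C k)"
  let ?A = "interval_lowerbound R" and ?B = "interval_upperbound R"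
  have C: "cbox (?a k) (?b k) = C k" if "k \<in> {1..n}" for k
    using hypercuboid_eq_cbox(1)[OF assms(3)[OF that]] by (rule sym)
  have "tiling {1..n} (\<lambda>k. cbox (?a k) (?b k)) R"
    using assms(4) C unfolding tiling_def disjoint_family_on_def by simp
  then have til: "tiling {1..n} (\<lambda>k. cbox (?a k) (?b k)) (cbox ?A ?B)"
    by (simp flip: hypercuboid_eq_cbox(1)[OF assms(2)])
  have "\<exists>l>0. l * (?B $ i - ?A $ i) \<le> 8 ^ card {1..n} * (\<Prod>k\<in>{1..n}. real (max (q k i) (q k j)))
      \<and> (\<forall>k\<in>{1..n}. l * c k \<in> \<int>)"
  proof (rule tiling_integer_scaling[OF til _ _ assms(9)])
    show "?a k $ m < ?b k $ m" if "k \<in> {1..n}" for k m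
      by (rule hypercuboid_eq_cbox(2)[OF assms(3)[OF that]])
    show "?A $ m < ?B $ m" for m by (rule hypercuboid_eq_cbox(2)[OF assms(2)])
  qed (use assms(5,7) in \<open>simp_all flip: side_length_def\<close>)
  then obtain l where l: "l > 0" "l * side_length R i \<le> 8 ^ n * (\<Prod>k=1..n. real (max (q k i) (q k j)))"
    and c: "\<And>k. k \<in> {1..n} \<Longrightarrow> l * c k \<in> \<int>"
    by (auto simp: side_length_def)
  \<comment> \<open>Scaling multiplies all sides by the same positive factor, so side
    \<open>i\<close> remains a longest one.\<close>
  have "longest_side ((\<lambda>x. l *\<^sub>R x) ` R) \<le> l * side_length R i"
    unfolding longest_side_def
  proof (rule Max.boundedI)
    fix s assume "s \<in> range (side_length ((\<lambda>x. l *\<^sub>R x) ` R))"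
    then obtain m where "s = l * side_length R m"
      using side_length_scaleR[OF assms(2) l(1)] by auto
    moreover have "side_length R m \<le> side_length R i"
      unfolding assms(8) longest_side_def by (rule Max_ge) simp_all
    ultimately show "s \<le> l * side_length R i" using l(1) by simp
  qed simp_all
  \<comment> \<open>Only directions \<open>i\<close> and \<open>j\<close> entered the system, but
    integrality of \<open>l * c k\<close> carries over to all sides of a tile, each being
    \<open>c k\<close> times an integer.\<close>
  moreover have "side_length ((\<lambda>x. l *\<^sub>R x) ` C k) m \<in> \<int>" if "k \<in> {1..n}" for k m
    using Ints_mult[OF c[OF that] Ints_of_nat[of "q k m"]] assms(7)[OF that]
    by (simp add: side_length_scaleR[OF assms(3)[OF that] l(1)] mult.assoc)
  ultimately show ?thesis using l by (intro exI[of _ l]) auto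
qed

end
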